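(* Let $\mathbb{M}$ be a complete MV-chain, $Y$ a finite set and $f:\mathbb{M}^Y\to\mathbb{M}^Y$ a non-expansive function. Let $a\in\mathbb{M}^Y$ be a fixpoint of $f$. Then $\nu f_a^{\#}=\emptyset$ if and only if $a=\nu f$.
   Context: MV-algebras: an MV-algebra is a tuple $\mathbb{M}=(M,\oplus,0,\overline{(\cdot)})$ where $(M,\oplus,0)$ is a commutative monoid and $\overline{(\cdot)}:M\to M$ satisfies $\overline{\overline{x}}=x$, $x\oplus\overline{0}=\overline{0}$ and $\overline{(\overline{x}\oplus y)}\oplus y=\overline{(\overline{y}\oplus x)}\oplus x$ for all $x,y$. Put $1=\overline{0}$, $x\otimes y=\overline{\overline{x}\oplus\overline{y}}$, $x\ominus y=x\otimes\overline{y}$. The natural order is $x\sqsubseteq y$ iff $x\oplus z=y$ for some $z$; it is a lattice order with bottom $0$ and top $1$. $\mathbb{M}$ is an MV-chain if $\sqsubseteq$ is total, and complete if $(M,\sqsubseteq)$ is a complete lattice. Function spaces: $\mathbb{M}^Y$ is the set of functions $Y\to M$ with pointwise order and operations; $[b,c]=\{d\mid b\sqsubseteq d\sqsubseteq c\}$. For $Y'\subseteq Y$, $\delta\in\mathbb{M}$, $\delta_{Y'}$ is the function with value $\delta$ on $Y'$ and $0$ elsewhere; $\delta$ also denotes the constant function $\delta_Y$. The norm is $\|a\|=\max\{a(y)\mid y\in Y\}$. A function $f:\mathbb{M}^Y\to\mathbb{M}^Z$ ($Y,Z$ finite) is non-expansive if $\|f(b)\ominus f(a)\|\sqsubseteq\|b\ominus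 a\|$ for all $a,b\in\mathbb{M}^Y$; such $f$ is monotone. Fixpoints: $\nu g$ denotes the greatest fixpoint of a monotone function $g$ on a complete lattice (here $\mathbb{M}^Y$, or a powerset ordered by inclusion). Approximations: for $a\in\mathbb{M}^Y$ let $[Y]_a=\{y\in Y\mid a(y)\neq 1\}$ and $\delta_a=\min\{\overline{a(y)}\mid y\in[Y]_a\}$ with $\min\emptyset=1$. For $\delta\in\mathbb{M}$ let $\alpha_{a,\delta}:\mathbf{2}^{[Y]_a}\to[a,a\oplus\delta]$, $\alpha_{a,\delta}(Y')=a\oplus\delta_{Y'}$, and $\gamma_{a,\delta}:[a,a\oplus\delta]\to\mathbf{2}^{[Y]_a}$, $\gamma_{a,\delta}(b)=\{y\in[Y]_a\mid b(y)\ominus a(y)\sqsupseteq\delta\}$. For non-expansive $f:\mathbb{M}^Y\to\mathbb{M}^Z$ put $f_{a,\delta}^{\#}=\gamma_{f(a),\delta}\circ f\circ\alpha_{a,\delta}:\mathbf{2}^{[Y]_a}\to\mathbf{2}^{[Z]_{f(a)}}$. For $Y'\subseteq[Y]_a$, $z\in[Z]_{f(a)}$ let $\iota_a^f(Y',z)=\max\{\theta\in\mathbb{M}\mid z\in f_{a,\theta}^{\#}(Y')\}$ (the maximum exists when $\mathbb{M}$ is a complete MV-chain), and $\iota_a^f=\min\big(\{\iota_a^f(Y',z)\mid Y'\subseteq[Y]_a,\ z\in[Z]_{f(a)},\ \iota_a^f(Y',z)\neq 0\}\cup\{\delta_a\}\big)$. The $a$-approximation of $f$ is $f_a^{\#}=f_{a,\iota_a^f}^{\#}$.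 When $Z=Y$ and $f(a)=a$ it is a monotone endofunction of $\mathbf{2}^{[Y]_a}$. *)

theory Defs
  imports "HOL-Algebra.Complete_Lattice" "HOL-Library.FuncSet"
begin

section \<open>MV-algebras and complete MV-chains\<close>

text \<open>The monoid operation and its unit are written \<open>+\<close> and \<open>0\<close>.\<close>

class mv_algebra = comm_monoid_add +
  fixes neg :: "'a \<Rightarrow> 'a"
  assumes neg_neg: "neg (neg x) = x"
    and add_neg_zero: "x + neg 0 = neg 0"
    and neg_add_swap: "neg (neg x + y) + y = neg (neg y + x) + x"
begin

definition mv_one :: 'a
  where "mv_one = neg 0"

definition mv_times :: "'a \<Rightarrow> 'a \<Rightarrow> 'a"
  where "mv_times x y = neg (neg x + neg y)"

definition mv_diff :: "'a \<Rightarrow> 'a \<Rightarrow> 'a" (infixl \<open>\<ominus>\<close> 65)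
  where "x \<ominus> y = mv_times x (neg y)"

end

text \<open>The order of the class is forced to be the natural order of the MV-algebra, so the
  superclass states exactly that the natural order is total and a complete lattice.\<close>

class complete_mv_chain = mv_algebra + complete_linorder +
  assumes less_eq_iff_add: "x \<le> y \<longleftrightarrow> (\<exists>z. x + z = y)"


section \<open>Function spaces\<close>

text \<open>Functions on a set \<open>Y\<close> are represented extensionally, as elements of
  \<open>Y \<rightarrow>\<^sub>E UNIV\<close>, so that equality of functions is equality on \<open>Y\<close>.\<close>

definition fun_lattice :: "'y set \<Rightarrow> ('y \<Rightarrow> 'm::complete_mv_chain) gorder"
  where "fun_lattice Y =
    \<lparr>carrier = Y \<rightarrow>\<^sub>E UNIV, eq = (=), le = (\<lambda>a b. \<forall>y\<in>Y. a y \<le> b y)\<rparr>"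

definition pow_lattice :: "'y set \<Rightarrow> 'y set gorder"
  where "pow_lattice A = \<lparr>carrier = Pow A, eq = (=), le = (\<subseteq>)\<rparr>"

text \<open>For empty \<open>Y\<close>, where there is no maximum, the norm is \<open>0\<close>, the least element.\<close>

definition mv_norm :: "'y set \<Rightarrow> ('y \<Rightarrow> 'm::complete_mv_chain) \<Rightarrow> 'm"
  where "mv_norm Y a = (if Y = {} then 0 else Max (a ` Y))"

definition nonexpansive ::
    "'y set \<Rightarrow> 'z set \<Rightarrow> (('y \<Rightarrow> 'm::complete_mv_chain) \<Rightarrow> 'z \<Rightarrow> 'm) \<Rightarrow> bool"
  where "nonexpansive Y Z f \<longleftrightarrow>
    f \<in> (Y \<rightarrow>\<^sub>E UNIV) \<rightarrow> (Z \<rightarrow>\<^sub>E UNIV) \<and>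
    (\<forall>a \<in> Y \<rightarrow>\<^sub>E UNIV. \<forall>b \<in> Y \<rightarrow>\<^sub>E UNIV.
      mv_norm Z (\<lambda>z. f b z \<ominus> f a z) \<le> mv_norm Y (\<lambda>y. b y \<ominus> a y))"


section \<open>Approximations\<close>

text \<open>The set written $[Y]_a$.\<close>

definition non_one :: "'y set \<Rightarrow> ('y \<Rightarrow> 'm::complete_mv_chain) \<Rightarrow> 'y set"
  where "non_one Y a = {y \<in> Y. a y \<noteq> mv_one}"

text \<open>The element written $\delta_a$.\<close>

definition delta :: "'y set \<Rightarrow> ('y \<Rightarrow> 'm::complete_mv_chain) \<Rightarrow> 'm"
  where "delta Y a =
    (if non_one Y a = {} then mv_one else Min ((\<lambda>y. neg (a y)) ` non_one Y a))"

text \<open>The function written $\delta_{Y'}$.\<close>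

definition step_fun :: "'y set \<Rightarrow> 'm::complete_mv_chain \<Rightarrow> 'y set \<Rightarrow> 'y \<Rightarrow> 'm"
  where "step_fun Y d Y' = (\<lambda>y\<in>Y. if y \<in> Y' then d else 0)"

text \<open>The maps \<open>\<alpha>\<close> and \<open>\<gamma>\<close> are meant on the domains \<open>Pow (non_one Y a)\<close> and
  $[a, a \oplus \delta]$; their values elsewhere play no role.\<close>

definition alpha ::
    "'y set \<Rightarrow> ('y \<Rightarrow> 'm::complete_mv_chain) \<Rightarrow> 'm \<Rightarrow> 'y set \<Rightarrow> 'y \<Rightarrow> 'm"
  where "alpha Y a d Y' = (\<lambda>y\<in>Y. a y + step_fun Y d Y' y)"

definition gamma ::
    "'y set \<Rightarrow> ('y \<Rightarrow> 'm::complete_mv_chain) \<Rightarrow> 'm \<Rightarrow> ('y \<Rightarrow> 'm) \<Rightarrow> 'y set"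
  where "gamma Y a d b = {y \<in> non_one Y a. d \<le> b y \<ominus> a y}"

definition approx_at ::
    "'y set \<Rightarrow> 'z set \<Rightarrow> (('y \<Rightarrow> 'm::complete_mv_chain) \<Rightarrow> 'z \<Rightarrow> 'm) \<Rightarrow>
      ('y \<Rightarrow> 'm) \<Rightarrow> 'm \<Rightarrow> 'y set \<Rightarrow> 'z set"
  where "approx_at Y Z f a d = gamma Z (f a) d \<circ> f \<circ> alpha Y a d"

text \<open>The set of admissible \<open>\<theta>\<close> may be infinite, hence \<open>GREATEST\<close> rather than \<open>Max\<close>.\<close>

definition iota_at ::
    "'y set \<Rightarrow> 'z set \<Rightarrow> (('y \<Rightarrow> 'm::complete_mv_chain) \<Rightarrow> 'z \<Rightarrow> 'm) \<Rightarrow>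
      ('y \<Rightarrow> 'm) \<Rightarrow> 'y set \<Rightarrow> 'z \<Rightarrow> 'm"
  where "iota_at Y Z f a Y' z = (GREATEST \<theta>. z \<in> approx_at Y Z f a \<theta> Y')"

definition iota ::
    "'y set \<Rightarrow> 'z set \<Rightarrow> (('y \<Rightarrow> 'm::complete_mv_chain) \<Rightarrow> 'z \<Rightarrow> 'm) \<Rightarrow>
      ('y \<Rightarrow> 'm) \<Rightarrow> 'm"
  where "iota Y Z f a =
    Min ({iota_at Y Z f a Y' z | Y' z.
            Y' \<subseteq> non_one Y a \<and> z \<in> non_one Z (f a) \<and> iota_at Y Z f a Y' z \<noteq> 0}
         \<union> {delta Y a})"

text \<open>The \<open>a\<close>-approximation $f_a^{\#}$.\<close>

definition approx ::
    "'y set \<Rightarrow> 'z set \<Rightarrow> (('y \<Rightarrow> 'm::complete_mv_chain) \<Rightarrow> 'z \<Rightarrow> 'm) \<Rightarrow>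
      ('y \<Rightarrow> 'm) \<Rightarrow> 'y set \<Rightarrow> 'z set"
  where "approx Y Z f a = approx_at Y Z f a (iota Y Z f a)"

end

theory Submission
  imports Defs
begin

text \<open>A function \<open>b\<close> with \<open>a \<le> b \<le> f b\<close> and \<open>a \<noteq> b\<close> yields a nonempty post-fixpoint of the
  approximation: the set \<open>Y'\<close> where \<open>b \<ominus> a\<close> attains its norm \<open>m\<close>. If \<open>m'\<close> is the largest value of
  \<open>b \<ominus> a\<close> outside \<open>Y'\<close> and \<open>\<theta> = m \<ominus> m'\<close>, then \<open>b\<close> exceeds \<open>a \<oplus> \<theta>\<^bsub>Y'\<^esub>\<close> by at most \<open>m'\<close>, so
  non-expansiveness forces \<open>f\<close> to lift every point of \<open>Y'\<close> by at least \<open>\<theta> > 0\<close>. Conversely, a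
  nonempty post-fixpoint \<open>Y'\<close> of the approximation makes \<open>a \<oplus> \<iota>\<^bsub>Y'\<^esub>\<close> a post-fixpoint of \<open>f\<close>
  strictly above \<open>a\<close>.\<close>

section \<open>Arithmetic of MV-algebras\<close>

context mv_algebra
begin

lemma add_mv_one: "x + mv_one = mv_one"
  by (simp add: mv_one_def add_neg_zero)

lemma mv_diff_eq: "x \<ominus> y = neg (neg x + y)"
  by (simp add: mv_diff_def mv_times_def neg_neg)

lemma neg_add_self: "neg x + x = mv_one"
proof -
  have "neg (neg (neg 0) + x) + x = neg (neg x + neg 0) + neg 0"
    by (rule neg_add_swap)
  then show ?thesis
    by (simp add: neg_neg add_neg_zero mv_one_def)
qed

lemma mv_diff_self: "x \<ominus> x = 0"
  by (simp add: mv_diff_eq neg_add_self mv_one_def neg_neg)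

lemma mv_diff_zero: "x \<ominus> 0 = x"
  by (simp add: mv_diff_eq neg_neg)

text \<open>Both sides are the meet of \<open>x\<close> and \<open>y\<close> in the natural order;
  the equation is the swap axiom read at the complements.\<close>

lemma mv_diff_mv_diff_swap: "x \<ominus> (x \<ominus> y) = y \<ominus> (y \<ominus> x)"
  using neg_add_swap[of "neg y" "neg x"]
  by (simp add: mv_diff_eq neg_neg add.commute)

end

context complete_mv_chain
begin

subclass canonically_ordered_monoid_add
  by standard (auto simp: less_eq_iff_add)

lemma le_add_self: "x \<le> x + y"
  by (auto simp: less_eq_iff_add)

text \<open>Makes the order equational. In the converse the swap axiom exhibits \<open>y\<close> as
  \<open>x\<close> plus the difference \<open>y \<ominus> x\<close>.\<close>

lemma le_iff_neg_add: "x \<le> y \<longleftrightarrow> neg x + y = mv_one"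
proof
  assume "x \<le> y"
  then obtain z where "y = x + z"
    by (auto simp: less_eq_iff_add)
  then show "neg x + y = mv_one"
    by (metis add.assoc add.commute add_mv_one neg_add_self)
next
  assume "neg x + y = mv_one"
  then have "neg (neg y + x) + x = y"
    using neg_add_swap[of x y] by (simp add: mv_one_def neg_neg)
  then show "x \<le> y"
    by (metis add.commute less_eq_iff_add)
qed

text \<open>Residuation, which drives all later estimates: both sides say that
  \<open>neg x + y + z\<close> is \<open>mv_one\<close>.\<close>

lemma mv_diff_le_iff: "x \<ominus> y \<le> z \<longleftrightarrow> x \<le> y + z"
  by (simp add: le_iff_neg_add mv_diff_eq neg_neg add.assoc)

lemma le_add_mv_diff: "x \<le> y + (x \<ominus> y)"
  by (simp flip: mv_diff_le_iff)

lemma mv_diff_eq_0_iff: "x \<ominus> y = 0 \<longleftrightarrow> x \<le> y"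
  using mv_diff_le_iff[of x y 0] by simp

lemma le_mv_one: "x \<le> mv_one"
  by (simp add: le_iff_neg_add add_mv_one)

lemma neg_eq_0_iff: "neg x = 0 \<longleftrightarrow> x = mv_one"
  by (metis mv_one_def neg_neg)

lemma add_mv_diff_cancel:
  assumes "y \<le> x"
  shows "y + (x \<ominus> y) = x"
  using assms neg_add_swap[of x y] mv_diff_eq_0_iff[of y x]
  by (simp add: mv_diff_eq add.commute)

text \<open>Addition is truncated at \<open>mv_one\<close>, so cancellation needs \<open>d\<close>
  to fit below \<open>neg x\<close>. The meet of \<open>d\<close> and \<open>neg x\<close>, computed
  in its two forms, is then both \<open>0\<close> and \<open>d\<close>.\<close>

lemma add_eq_self_imp_0:
  assumes "d \<le> neg x" and "x + d = x"
  shows "d = 0"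
proof -
  have "neg x \<ominus> d = neg x"
    by (simp add: mv_diff_eq neg_neg assms(2))
  then have "d \<ominus> (d \<ominus> neg x) = 0"
    using mv_diff_mv_diff_swap[of d "neg x"] by (simp add: mv_diff_self)
  moreover have "d \<ominus> neg x = 0"
    using assms(1) by (simp add: mv_diff_eq_0_iff)
  ultimately show ?thesis
    by (simp add: mv_diff_zero)
qed

end

section \<open>Non-expansive functions\<close>

lemma mv_norm_le_iff:
  assumes "finite Y"
  shows "mv_norm Y a \<le> d \<longleftrightarrow> (\<forall>y\<in>Y. a y \<le> d)"
  using assms by (auto simp: mv_norm_def)

lemma nonexpansive_carrier:
  assumes "nonexpansive Y Z f" and "a \<in> Y \<rightarrow>\<^sub>E UNIV"
  shows "f a \<in> Z \<rightarrow>\<^sub>E UNIV"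
  using assms unfolding nonexpansive_def by blast

text \<open>Residuation turns the comparison of norms into a pointwise, one-sided estimate; with
  \<open>d = 0\<close> it becomes monotonicity.\<close>

lemma nonexpansive_le_add:
  assumes "finite Y" "finite Z" "nonexpansive Y Z f"
    and "a \<in> Y \<rightarrow>\<^sub>E UNIV" "b \<in> Y \<rightarrow>\<^sub>E UNIV"
    and "\<And>y. y \<in> Y \<Longrightarrow> b y \<le> a y + d"
    and "z \<in> Z"
  shows "f b z \<le> f a z + d"
proof -
  have "mv_norm Y (\<lambda>y. b y \<ominus> a y) \<le> d"
    using assms by (simp add: mv_norm_le_iff mv_diff_le_iff)
  moreover have "mv_norm Z (\<lambda>z. f b z \<ominus> f a z) \<le> mv_norm Y (\<lambda>y. b y \<ominus> a y)"
    using assms unfolding nonexpansive_def by blast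
  ultimately have "mv_norm Z (\<lambda>z. f b z \<ominus> f a z) \<le> d"
    by (rule order_trans[rotated])
  then show ?thesis
    using assms by (simp add: mv_norm_le_iff mv_diff_le_iff)
qed

lemma nonexpansive_mono:
  assumes "finite Y" "finite Z" "nonexpansive Y Z f"
    and "a \<in> Y \<rightarrow>\<^sub>E UNIV" "b \<in> Y \<rightarrow>\<^sub>E UNIV"
    and "\<And>y. y \<in> Y \<Longrightarrow> a y \<le> b y"
    and "z \<in> Z"
  shows "f a z \<le> f b z"
  using nonexpansive_le_add[of Y Z f b a 0 z] assms by simp


section \<open>Approximations\<close>

lemma alpha_carrier: "alpha Y a d Y' \<in> Y \<rightarrow>\<^sub>E UNIV"
  by (simp add: alpha_def)

lemma alpha_apply: "y \<in> Y \<Longrightarrow> alpha Y a d Y' y = (if y \<in> Y' then a y + d else a y)"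
  by (simp add: alpha_def step_fun_def)

lemma mem_approx_at_iff:
  "z \<in> approx_at Y Z f a d Y' \<longleftrightarrow>
    z \<in> non_one Z (f a) \<and> d \<le> f (alpha Y a d Y') z \<ominus> f a z"
  by (simp add: approx_at_def gamma_def)

text \<open>The admissible values form the post-fixpoints of a monotone map, so their supremum is
  again admissible.\<close>

lemma mem_approx_at_iota_at:
  assumes fin: "finite Y" "finite Z" and f: "nonexpansive Y Z f"
    and z: "z \<in> non_one Z (f a)"
  shows "z \<in> approx_at Y Z f a (iota_at Y Z f a Y' z) Y'"
    and "z \<in> approx_at Y Z f a \<theta> Y' \<Longrightarrow> \<theta> \<le> iota_at Y Z f a Y' z"
proof -
  define S where "S = {\<theta>. z \<in> approx_at Y Z f a \<theta> Y'}"
  have "Sup S \<le> f (alpha Y a (Sup S) Y') z \<ominus> f a z"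
  proof (rule Sup_least)
    fix t assume t: "t \<in> S"
    then have "t \<le> f (alpha Y a t Y') z \<ominus> f a z"
      by (simp add: S_def mem_approx_at_iff)
    moreover have "f (alpha Y a t Y') z \<le> f (alpha Y a (Sup S) Y') z"
      using z t by (intro nonexpansive_mono[OF fin f alpha_carrier alpha_carrier])
        (auto simp: alpha_apply non_one_def intro: add_mono Sup_upper)
    then have "f (alpha Y a t Y') z \<ominus> f a z \<le> f (alpha Y a (Sup S) Y') z \<ominus> f a z"
      using le_add_mv_diff by (auto simp: mv_diff_le_iff intro: order_trans)
    ultimately show "t \<le> f (alpha Y a (Sup S) Y') z \<ominus> f a z"
      by (rule order_trans)
  qed
  then have S: "z \<in> approx_at Y Z f a (Sup S) Y'"
    using z by (simp add: mem_approx_at_iff)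
  have upper: "\<theta> \<le> Sup S" if "z \<in> approx_at Y Z f a \<theta> Y'" for \<theta>
    using that by (auto simp: S_def intro: Sup_upper)
  have eq: "iota_at Y Z f a Y' z = Sup S"
    unfolding iota_at_def using S upper by (rule Greatest_equality)
  show "z \<in> approx_at Y Z f a (iota_at Y Z f a Y' z) Y'"
    by (simp add: eq S)
  show "z \<in> approx_at Y Z f a \<theta> Y' \<Longrightarrow> \<theta> \<le> iota_at Y Z f a Y' z"
    by (simp add: eq upper)
qed

text \<open>Lowering \<open>d\<close> to \<open>\<theta>\<close> lowers the argument of
  \<open>f\<close>, and hence its value, by at most \<open>d \<ominus> \<theta>\<close>. Of a lift
  by \<open>d\<close> there remains at least \<open>d \<ominus> (d \<ominus> \<theta>)\<close>,
  which is \<open>\<theta>\<close>.\<close>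

lemma approx_at_antimono:
  assumes fin: "finite Y" "finite Z" and f: "nonexpansive Y Z f"
    and z: "z \<in> approx_at Y Z f a d Y'" and "\<theta> \<le> d"
  shows "z \<in> approx_at Y Z f a \<theta> Y'"
proof -
  have zZ: "z \<in> Z" and z1: "z \<in> non_one Z (f a)"
    and d: "d \<le> f (alpha Y a d Y') z \<ominus> f a z"
    using z by (auto simp: mem_approx_at_iff non_one_def)
  define u where "u = f (alpha Y a \<theta> Y') z \<ominus> f a z"
  have "f (alpha Y a d Y') z \<le> f (alpha Y a \<theta> Y') z + (d \<ominus> \<theta>)"
    using zZ by (intro nonexpansive_le_add[OF fin f alpha_carrier alpha_carrier])
      (auto simp: alpha_apply add.assoc intro: add_left_mono le_add_mv_diff le_add_self)
  also have "\<dots> \<le> (f a z + u) + (d \<ominus> \<theta>)"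
    unfolding u_def by (intro add_right_mono le_add_mv_diff)
  finally have "f (alpha Y a d Y') z \<ominus> f a z \<le> u + (d \<ominus> \<theta>)"
    by (simp add: mv_diff_le_iff add.assoc)
  with d have "d \<le> (d \<ominus> \<theta>) + u"
    by (simp add: add.commute)
  then have "d \<ominus> (d \<ominus> \<theta>) \<le> u"
    by (simp add: mv_diff_le_iff)
  moreover have "d \<ominus> (d \<ominus> \<theta>) = \<theta>"
    using \<open>\<theta> \<le> d\<close> mv_diff_mv_diff_swap[of d \<theta>] mv_diff_eq_0_iff[of \<theta> d]
    by (simp add: mv_diff_zero)
  ultimately show ?thesis
    using z1 by (simp add: mem_approx_at_iff u_def)
qed

lemma delta_le:
  assumes "finite Y" "y \<in> non_one Y a"
  shows "delta Y a \<le> neg (a y)"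
  using assms by (auto simp: delta_def non_one_def)

lemma delta_neq_0:
  fixes a :: "'y \<Rightarrow> 'm::complete_mv_chain"
  assumes "finite Y" "non_one Y a \<noteq> {}"
  shows "delta Y a \<noteq> 0"
proof -
  have "finite (non_one Y a)"
    using assms by (simp add: non_one_def)
  then have "delta Y a \<in> (\<lambda>y. neg (a y)) ` non_one Y a"
    using assms unfolding delta_def by (auto intro!: Min_in simp del: Min_in)
  then show ?thesis
    by (auto simp: neg_eq_0_iff non_one_def)
qed

context
  fixes Y :: "'y set" and Z :: "'z set"
    and f :: "('y \<Rightarrow> 'm::complete_mv_chain) \<Rightarrow> 'z \<Rightarrow> 'm" and a :: "'y \<Rightarrow> 'm"
  assumes fin: "finite Y" "finite Z"
begin

private definition "candidates =
  {iota_at Y Z f a Y' z | Y' z.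
     Y' \<subseteq> non_one Y a \<and> z \<in> non_one Z (f a) \<and> iota_at Y Z f a Y' z \<noteq> 0} \<union> {delta Y a}"

text \<open>The algebra may be infinite, but the values are indexed by finitely many pairs
  \<open>(Y', z)\<close>.\<close>

private lemma finite_candidates: "finite candidates"
proof -
  have "finite (Pow (non_one Y a) \<times> non_one Z (f a))"
    using fin by (simp add: non_one_def)
  then have "finite ((\<lambda>(Y', z). iota_at Y Z f a Y' z) ` (Pow (non_one Y a) \<times> non_one Z (f a)))"
    by (rule finite_imageI)
  then have "finite {iota_at Y Z f a Y' z | Y' z.
     Y' \<subseteq> non_one Y a \<and> z \<in> non_one Z (f a) \<and> iota_at Y Z f a Y' z \<noteq> 0}"
    by (rule rev_finite_subset) force
  then show ?thesis
    by (simp add: candidates_def)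
qed

private lemma iota_eq: "iota Y Z f a = Min candidates"
  by (simp add: iota_def candidates_def)

lemma iota_le_delta: "iota Y Z f a \<le> delta Y a"
  unfolding iota_eq by (rule Min_le[OF finite_candidates]) (simp add: candidates_def)

lemma iota_le_iota_at:
  assumes "Y' \<subseteq> non_one Y a" "z \<in> non_one Z (f a)" "iota_at Y Z f a Y' z \<noteq> 0"
  shows "iota Y Z f a \<le> iota_at Y Z f a Y' z"
  unfolding iota_eq
  by (rule Min_le[OF finite_candidates]) (use assms in \<open>auto simp: candidates_def\<close>)

text \<open>A finite minimum is attained, zero values of \<open>iota_at\<close> are excluded from
  the candidates, and \<open>delta Y a\<close> is nonzero once \<open>a\<close> differs from
  \<open>mv_one\<close> somewhere on \<open>Y\<close>.\<close>

lemma iota_neq_0: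
  assumes "non_one Y a \<noteq> {}"
  shows "iota Y Z f a \<noteq> 0"
proof -
  have "iota Y Z f a \<in> candidates"
    unfolding iota_eq by (rule Min_in[OF finite_candidates]) (simp add: candidates_def)
  then show ?thesis
    using delta_neq_0[OF fin(1) assms] by (auto simp: candidates_def)
qed

text \<open>Any nonzero lift is enough, however it compares with \<open>iota\<close>: it makes
  \<open>iota_at\<close> nonzero, hence at least \<open>iota\<close>, and membership passes down
  from \<open>iota_at\<close> to \<open>iota\<close>.\<close>

lemma mem_approxI:
  assumes "nonexpansive Y Z f" "Y' \<subseteq> non_one Y a"
    and "z \<in> approx_at Y Z f a \<theta> Y'" "\<theta> \<noteq> 0"
  shows "z \<in> approx Y Z f a Y'"
proof -
  have z: "z \<in> non_one Z (f a)"
    using assms(3) by (simp add: mem_approx_at_iff)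
  note iota_at = mem_approx_at_iota_at[OF fin assms(1) z]
  have "\<theta> \<le> iota_at Y Z f a Y' z"
    by (rule iota_at(2)[OF assms(3)])
  with assms(4) have "iota_at Y Z f a Y' z \<noteq> 0"
    by auto
  then have "iota Y Z f a \<le> iota_at Y Z f a Y' z"
    by (intro iota_le_iota_at assms z)
  then show ?thesis
    unfolding approx_def by (rule approx_at_antimono[OF fin assms(1) iota_at(1)])
qed

end


section \<open>Post-fixpoints\<close>

lemma approx_post_fixpoint_if_post_fixpoint:
  fixes a b :: "'y \<Rightarrow> 'm::complete_mv_chain"
  assumes fin: "finite Y" and f: "nonexpansive Y Y f"
    and a: "a \<in> Y \<rightarrow>\<^sub>E UNIV" "f a = a" and b: "b \<in> Y \<rightarrow>\<^sub>E UNIV"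
    and ab: "\<And>y. y \<in> Y \<Longrightarrow> a y \<le> b y" and bf: "\<And>y. y \<in> Y \<Longrightarrow> b y \<le> f b y"
    and "a \<noteq> b"
  obtains Y' where "Y' \<noteq> {}" "Y' \<subseteq> non_one Y a" "Y' \<subseteq> approx Y Y f a Y'"
proof -
  obtain y0 where y0: "y0 \<in> Y" "a y0 \<noteq> b y0"
    using \<open>a \<noteq> b\<close> a(1) b by (metis PiE_ext)
  define e where "e = (\<lambda>y. b y \<ominus> a y)"
  define m where "m = Max (e ` Y)"
  define Y' where "Y' = {y \<in> Y. e y = m}"
  \<comment> \<open>The inserted \<open>0\<close> gives the maximum a value when \<open>Y'\<close>
    is all of \<open>Y\<close>; then \<open>\<theta>\<close> is \<open>m\<close>.\<close>
  define m' where "m' = Max (insert 0 (e ` (Y - Y')))"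
  define \<theta> where "\<theta> = m \<ominus> m'"
  have e_le: "e y \<le> m" if "y \<in> Y" for y
    using that fin by (simp add: m_def)
  have m0: "m \<noteq> 0"
  proof
    assume "m = 0"
    then have "e y0 = 0"
      using e_le[OF y0(1)] by simp
    then show False
      using ab[OF y0(1)] y0(2) by (simp add: e_def mv_diff_eq_0_iff)
  qed
  have "m \<in> e ` Y"
    unfolding m_def using fin y0(1) by (intro Max_in) auto
  then have ne: "Y' \<noteq> {}"
    by (auto simp: Y'_def)
  \<comment> \<open>Where \<open>a\<close> is \<open>mv_one\<close> the excess \<open>e\<close> is
    \<open>0\<close>, which is not \<open>m\<close>.\<close>
  have sub: "Y' \<subseteq> non_one Y a"
    using m0 by (auto simp: Y'_def non_one_def e_def mv_diff_eq_0_iff le_mv_one)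
  have e_le': "e y \<le> m'" if "y \<in> Y" "y \<notin> Y'" for y
    using that fin by (simp add: m'_def)
  have "m' \<in> insert 0 (e ` (Y - Y'))"
    unfolding m'_def using fin by (intro Max_in) auto
  then have "m' < m"
    using m0 e_le by (auto simp: Y'_def less_le)
  then have \<theta>: "\<theta> \<noteq> 0"
    by (simp add: \<theta>_def mv_diff_eq_0_iff)
  have m_le: "m \<le> \<theta> + m'"
    using le_add_mv_diff[of m m'] by (simp add: \<theta>_def add.commute)
  define c where "c = alpha Y a \<theta> Y'"
  have bc: "b y \<le> c y + m'" if y: "y \<in> Y" for y
  proof -
    have "b y \<le> a y + e y"
      by (simp add: e_def le_add_mv_diff)
    also have "\<dots> \<le> c y + m'"
    proof (cases "y \<in> Y'")
      case True
      then have "e y \<le> \<theta> + m'"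
        using m_le by (simp add: Y'_def)
      then show ?thesis
        using True y by (simp add: c_def alpha_apply add.assoc add_left_mono)
    next
      case False
      then show ?thesis
        using e_le'[OF y] y by (simp add: c_def alpha_apply add_left_mono)
    qed
    finally show ?thesis .
  qed
  have "y \<in> approx_at Y Y f a \<theta> Y'" if y: "y \<in> Y'" for y
  proof -
    have yY: "y \<in> Y"
      using y by (simp add: Y'_def)
    define v where "v = f c y \<ominus> a y"
    have "b y \<le> f b y"
      by (rule bf[OF yY])
    also have "\<dots> \<le> f c y + m'"
      using bc yY by (intro nonexpansive_le_add[OF fin fin f _ b])
        (simp_all add: c_def alpha_carrier)
    also have "\<dots> \<le> (a y + v) + m'"
      unfolding v_def by (intro add_right_mono le_add_mv_diff)
    finally have "e y \<le> v + m'"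
      by (simp add: e_def mv_diff_le_iff add.assoc)
    \<comment> \<open>On \<open>Y'\<close> the excess \<open>e y\<close> equals \<open>m\<close>, so
      residuation applies to \<open>m \<le> v + m'\<close>.\<close>
    then have "\<theta> \<le> v"
      using y by (simp add: Y'_def \<theta>_def mv_diff_le_iff add.commute)
    then show ?thesis
      using y sub by (auto simp: mem_approx_at_iff a(2) v_def c_def)
  qed
  \<comment> \<open>The lift \<open>\<theta>\<close> depends on \<open>b\<close> and may differ from
    \<open>iota\<close>; that it is nonzero suffices.\<close>
  then have "Y' \<subseteq> approx Y Y f a Y'"
    using \<theta> by (auto intro: mem_approxI[OF fin fin f sub])
  with ne sub show thesis
    by (rule that)
qed

text \<open>On \<open>Y'\<close>, membership in the approximation says that \<open>f\<close> lifts
  the value by at least \<open>iota\<close>. Off \<open>Y'\<close> nothing was added to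
  \<open>a\<close>, and monotonicity keeps the value above \<open>f a = a\<close>.\<close>

lemma alpha_post_fixpoint_if_approx_post_fixpoint:
  assumes fin: "finite Y" and f: "nonexpansive Y Y f"
    and a: "a \<in> Y \<rightarrow>\<^sub>E UNIV" "f a = a"
    and Y': "Y' \<subseteq> approx Y Y f a Y'" and y: "y \<in> Y"
  shows "alpha Y a (iota Y Y f a) Y' y \<le> f (alpha Y a (iota Y Y f a) Y') y"
proof -
  define c where "c = alpha Y a (iota Y Y f a) Y'"
  have "f a y \<le> f c y"
    using y by (intro nonexpansive_mono[OF fin fin f a(1)])
      (auto simp: c_def alpha_carrier alpha_apply le_add_self)
  then have ac: "a y \<le> f c y"
    by (simp add: a(2))
  have "c y \<le> f c y"
  proof (cases "y \<in> Y'")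
    case True
    then have "iota Y Y f a \<le> f c y \<ominus> a y"
      using Y' by (auto simp: approx_def mem_approx_at_iff a(2) c_def)
    then have "a y + iota Y Y f a \<le> a y + (f c y \<ominus> a y)"
      by (rule add_left_mono)
    also have "\<dots> = f c y"
      using ac by (rule add_mv_diff_cancel)
    finally show ?thesis
      using True y by (simp add: c_def alpha_apply)
  next
    case False
    then show ?thesis
      using ac y by (simp add: c_def alpha_apply)
  qed
  then show ?thesis
    by (simp add: c_def)
qed

text \<open>Truncation cannot absorb the added amount: \<open>iota\<close> is nonzero and at most
  \<open>delta Y a\<close>, so it fits below \<open>neg (a y)\<close> at every point of
  \<open>Y'\<close>.\<close>

lemma alpha_iota_neq:
  assumes fin: "finite Y" "finite Z" and "Y' \<noteq> {}" "Y' \<subseteq> non_one Y a"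
  shows "alpha Y a (iota Y Z f a) Y' \<noteq> a"
proof
  assume eq: "alpha Y a (iota Y Z f a) Y' = a"
  obtain y where y: "y \<in> Y'" "y \<in> non_one Y a"
    using assms by blast
  then have "y \<in> Y"
    by (simp add: non_one_def)
  have "iota Y Z f a \<le> neg (a y)"
    using iota_le_delta[OF fin] delta_le[OF fin(1) y(2)] by (rule order_trans)
  moreover have "a y + iota Y Z f a = a y"
    using fun_cong[OF eq, of y] y \<open>y \<in> Y\<close> by (simp add: alpha_apply)
  ultimately have "iota Y Z f a = 0"
    by (rule add_eq_self_imp_0)
  then show False
    using iota_neq_0[OF fin] y by blast
qed


section \<open>Greatest fixpoints\<close>

text \<open>Joins and meets are pointwise, restricted to \<open>Y\<close> so as to stay extensional;
  antisymmetry holds because extensional functions agreeing on \<open>Y\<close> are equal.\<close>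

lemma complete_lattice_fun_lattice:
  "complete_lattice (fun_lattice Y :: ('y \<Rightarrow> 'm::complete_mv_chain) gorder)"
    (is "complete_lattice ?L")
proof -
  have antisym: "x = y"
    if "x \<in> Y \<rightarrow>\<^sub>E UNIV" "y \<in> Y \<rightarrow>\<^sub>E UNIV"
      "\<forall>i\<in>Y. x i \<le> y i" "\<forall>i\<in>Y. y i \<le> x i" for x y :: "'y \<Rightarrow> 'm"
    using that by (intro PiE_ext[of x Y _ y]) (auto intro: order_antisym)
  interpret partial_order ?L
    by standard (auto simp: fun_lattice_def intro: antisym order_trans)
  show ?thesis
  proof
    fix A :: "('y \<Rightarrow> 'm) set"
    assume A: "A \<subseteq> carrier ?L"
    have "least ?L (\<lambda>y\<in>Y. SUP a\<in>A. a y) (Upper ?L A)"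
    proof (rule least_UpperI)
      fix x assume "x \<in> A"
      then show "x \<sqsubseteq>\<^bsub>?L\<^esub> (\<lambda>y\<in>Y. SUP a\<in>A. a y)"
        by (auto simp: fun_lattice_def intro: SUP_upper)
    next
      fix x assume "x \<in> Upper ?L A"
      then have "a y \<le> x y" if "a \<in> A" "y \<in> Y" for a y
        using A that by (auto simp: Upper_def fun_lattice_def)
      then show "(\<lambda>y\<in>Y. SUP a\<in>A. a y) \<sqsubseteq>\<^bsub>?L\<^esub> x"
        by (auto simp: fun_lattice_def intro: SUP_least)
    qed (use A in \<open>auto simp: fun_lattice_def\<close>)
    then show "\<exists>s. is_lub ?L s A"
      by blast
    have "greatest ?L (\<lambda>y\<in>Y. INF a\<in>A. a y) (Lower ?L A)"
    proof (rule greatest_LowerI)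
      fix x assume "x \<in> A"
      then show "(\<lambda>y\<in>Y. INF a\<in>A. a y) \<sqsubseteq>\<^bsub>?L\<^esub> x"
        by (auto simp: fun_lattice_def intro: INF_lower)
    next
      fix x assume "x \<in> Lower ?L A"
      then have "x y \<le> a y" if "a \<in> A" "y \<in> Y" for a y
        using A that by (auto simp: Lower_def fun_lattice_def)
      then show "x \<sqsubseteq>\<^bsub>?L\<^esub> (\<lambda>y\<in>Y. INF a\<in>A. a y)"
        by (auto simp: fun_lattice_def intro: INF_greatest)
    qed (use A in \<open>auto simp: fun_lattice_def\<close>)
    then show "\<exists>i. is_glb ?L i A"
      by blast
  qed
qed

lemma complete_lattice_pow_lattice: "complete_lattice (pow_lattice A)"
proof -
  interpret partial_order "pow_lattice A"
    by standard (auto simp: pow_lattice_def)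
  show ?thesis
  proof
    fix B assume B: "B \<subseteq> carrier (pow_lattice A)"
    then have "least (pow_lattice A) (\<Union>B) (Upper (pow_lattice A) B)"
      by (intro least_UpperI) (force simp: pow_lattice_def Upper_def)+
    then show "\<exists>s. is_lub (pow_lattice A) s B"
      by blast
    \<comment> \<open>Intersecting with \<open>A\<close> matters for empty \<open>B\<close>, whose
      intersection is the whole type.\<close>
    have "greatest (pow_lattice A) (A \<inter> \<Inter>B) (Lower (pow_lattice A) B)"
      using B by (intro greatest_LowerI) (force simp: pow_lattice_def Lower_def)+
    then show "\<exists>i. is_glb (pow_lattice A) i B"
      by blast
  qed
qed

text \<open>\<open>GFP\<close> is the join of all post-fixpoints, so it is empty exactly when each
  of them is.\<close>

lemma GFP_pow_lattice_eq_empty_iff: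
  "GFP\<^bsub>pow_lattice A\<^esub> g = {} \<longleftrightarrow> (\<forall>B\<subseteq>A. B \<subseteq> g B \<longrightarrow> B = {})"
proof -
  interpret complete_lattice "pow_lattice A"
    by (rule complete_lattice_pow_lattice)
  show ?thesis
  proof
    assume "GFP\<^bsub>pow_lattice A\<^esub> g = {}"
    then show "\<forall>B\<subseteq>A. B \<subseteq> g B \<longrightarrow> B = {}"
      using GFP_upperbound[of _ g] by (auto simp: pow_lattice_def)
  next
    assume "\<forall>B\<subseteq>A. B \<subseteq> g B \<longrightarrow> B = {}"
    then have "GFP\<^bsub>pow_lattice A\<^esub> g \<subseteq> {}"
      using GFP_least[of "{}" g] by (simp add: pow_lattice_def)
    then show "GFP\<^bsub>pow_lattice A\<^esub> g = {}"
      by simp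
  qed
qed

theorem theorem4p2:
  fixes Y :: "'y set"
    and f :: "('y \<Rightarrow> 'm::complete_mv_chain) \<Rightarrow> 'y \<Rightarrow> 'm"
    and a :: "'y \<Rightarrow> 'm"
  assumes "finite Y"
    and "nonexpansive Y Y f"
    and "a \<in> Y \<rightarrow>\<^sub>E UNIV"
    and "f a = a"
  shows "GFP\<^bsub>pow_lattice (non_one Y a)\<^esub> (approx Y Y f a) = {}
    \<longleftrightarrow> a = GFP\<^bsub>fun_lattice Y\<^esub> f"
proof -
  interpret L: complete_lattice "fun_lattice Y :: ('y \<Rightarrow> 'm) gorder"
    by (rule complete_lattice_fun_lattice)
  define b where "b = GFP\<^bsub>fun_lattice Y\<^esub> f"
  have b: "b \<in> Y \<rightarrow>\<^sub>E UNIV"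
    using L.GFP_closed[of f] by (simp add: b_def fun_lattice_def)
  have upper: "c y \<le> b y"
    if "c \<in> Y \<rightarrow>\<^sub>E UNIV" "\<And>y. y \<in> Y \<Longrightarrow> c y \<le> f c y" "y \<in> Y" for c y
    using L.GFP_upperbound[of c f] that by (simp add: b_def fun_lattice_def)
  have ab: "a y \<le> b y" if "y \<in> Y" for y
    using assms(3,4) that by (intro upper) simp_all
  \<comment> \<open>Half of the Knaster-Tarski argument: a post-fixpoint \<open>u\<close> lies below
    \<open>f u\<close>, hence below \<open>f b\<close> by monotonicity, so \<open>f b\<close> bounds
    the join \<open>b\<close> of them all.\<close>
  have bf: "b y \<le> f b y" if y: "y \<in> Y" for y
  proof -
    have fb: "f b \<in> Y \<rightarrow>\<^sub>E UNIV"
      by (rule nonexpansive_carrier[OF assms(2) b])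
    have "b \<sqsubseteq>\<^bsub>fun_lattice Y\<^esub> f b"
      unfolding b_def
    proof (rule L.GFP_least)
      fix u assume u: "u \<in> carrier (fun_lattice Y)" "u \<sqsubseteq>\<^bsub>fun_lattice Y\<^esub> f u"
      then have "u y \<le> b y" if "y \<in> Y" for y
        using that by (intro upper) (auto simp: fun_lattice_def)
      then have "f u y \<le> f b y" if "y \<in> Y" for y
        using that u b by (intro nonexpansive_mono[OF assms(1,1,2)])
          (auto simp: fun_lattice_def)
      with u show "u \<sqsubseteq>\<^bsub>fun_lattice Y\<^esub> f (GFP\<^bsub>fun_lattice Y\<^esub> f)"
        unfolding b_def[symmetric] by (auto simp: fun_lattice_def intro: order_trans)
    qed (use fb in \<open>simp add: fun_lattice_def b_def\<close>)
    with y show ?thesis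
      by (simp add: fun_lattice_def)
  qed
  have "(\<forall>Y'\<subseteq>non_one Y a. Y' \<subseteq> approx Y Y f a Y' \<longrightarrow> Y' = {}) \<longleftrightarrow> a = b"
  proof
    assume *: "\<forall>Y'\<subseteq>non_one Y a. Y' \<subseteq> approx Y Y f a Y' \<longrightarrow> Y' = {}"
    show "a = b"
    proof (rule ccontr)
      assume "a \<noteq> b"
      then obtain Y' where "Y' \<noteq> {}" "Y' \<subseteq> non_one Y a" "Y' \<subseteq> approx Y Y f a Y'"
        using approx_post_fixpoint_if_post_fixpoint[OF assms b ab bf] by blast
      with * show False
        by blast
    qed
  next
    assume eq: "a = b"
    show "\<forall>Y'\<subseteq>non_one Y a. Y' \<subseteq> approx Y Y f a Y' \<longrightarrow> Y' = {}"
    proof (intro allI impI, rule ccontr)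
      fix Y' assume Y': "Y' \<subseteq> non_one Y a" "Y' \<subseteq> approx Y Y f a Y'" "Y' \<noteq> {}"
      define c where "c = alpha Y a (iota Y Y f a) Y'"
      have c: "c \<in> Y \<rightarrow>\<^sub>E UNIV"
        by (simp add: c_def alpha_carrier)
      \<comment> \<open>As a post-fixpoint of \<open>f\<close>, \<open>c\<close> lies below
        \<open>b\<close>, which is \<open>a\<close> here; by construction it also lies above
        \<open>a\<close>.\<close>
      have "c y = a y" if y: "y \<in> Y" for y
      proof (rule order_antisym)
        show "c y \<le> a y"
          unfolding eq using y c
          by (intro upper) (simp_all add: c_def
            alpha_post_fixpoint_if_approx_post_fixpoint[OF assms Y'(2)])
        show "a y \<le> c y"
          using y by (simp add: c_def alpha_apply le_add_self)
      qed
      then have "c = a"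
        using c assms(3) by (blast intro: PiE_ext)
      then show False
        using alpha_iota_neq[OF assms(1,1) Y'(3,1), of f] by (simp add: c_def)
    qed
  qed
  then show ?thesis
    by (simp add: GFP_pow_lattice_eq_empty_iff b_def)
qed

end
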